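(* Let $\Omega\subset\mathbb C^n$ be a bounded domain, $p\ge1$, and $z\in\Omega$. For $c\in\mathbb C$ set $$H^c_{p,z}:=\{f\in A^p(\Omega): f(z)=c\}.$$ Then, for every $c\in\mathbb C$, $m_p(z)$ is the distance (with respect to $\|\cdot\|_p$) between $H^c_{p,z}$ and $H^{c+1}_{p,z}$.
   Context: $A^p(\Omega)$ is the space of holomorphic functions $f$ on $\Omega$ with $\|f\|_p^p:=\int_\Omega|f|^p<\infty$ (Lebesgue measure), and $m_p(z):=\inf\{\|f\|_p: f\in A^p(\Omega),\ f(z)=1\}$. The distance between two subsets $A,B$ of $A^p(\Omega)$ is $\inf\{\|f-g\|_p: f\in A,\ g\in B\}$. *)

theory Defs
  imports "HOL-Analysis.Analysis"
begin

(* The library's holomorphic_on covers one complex variable only.  A function of several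
   complex variables is holomorphic if it is complex differentiable at every point, i.e. its
   (real) Frechet derivative is complex-linear.  The notion is meant for open S, where
   "at z within S" coincides with "at z". *)
definition holomorphic_Cn_on :: "(complex ^ 'n \<Rightarrow> complex) \<Rightarrow> (complex ^ 'n) set \<Rightarrow> bool" where
  "holomorphic_Cn_on f S \<longleftrightarrow>
     (\<forall>z\<in>S. \<exists>f'. (f has_derivative f') (at z within S) \<and> (\<forall>c v. f' (c *s v) = c * f' v))"

(* HOL functions are total: an element of bergman_space p \<Omega> has arbitrary values outside \<Omega>,
   and for z in \<Omega> none of the notions below depends on those values. *)
definition bergman_space :: "real \<Rightarrow> (complex ^ 'n) set \<Rightarrow> (complex ^ 'n \<Rightarrow> complex) set" where
  "bergman_space p \<Omega> =
     {f. holomorphic_Cn_on f \<Omega> \<and> set_integrable lebesgue \<Omega> (\<lambda>z. norm (f z) powr p)}"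

definition bergman_norm :: "real \<Rightarrow> (complex ^ 'n) set \<Rightarrow> (complex ^ 'n \<Rightarrow> complex) \<Rightarrow> real" where
  "bergman_norm p \<Omega> f = (LINT z:\<Omega>|lebesgue. norm (f z) powr p) powr (1 / p)"

definition bergman_min :: "real \<Rightarrow> (complex ^ 'n) set \<Rightarrow> complex ^ 'n \<Rightarrow> real" where
  "bergman_min p \<Omega> z = Inf {bergman_norm p \<Omega> f | f. f \<in> bergman_space p \<Omega> \<and> f z = 1}"

definition bergman_hyperplane ::
    "real \<Rightarrow> (complex ^ 'n) set \<Rightarrow> complex ^ 'n \<Rightarrow> complex \<Rightarrow> (complex ^ 'n \<Rightarrow> complex) set" where
  "bergman_hyperplane p \<Omega> z c = {f \<in> bergman_space p \<Omega>. f z = c}"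

(* Intended for nonempty subsets A, B of bergman_space p \<Omega>. *)
definition bergman_setdist ::
    "real \<Rightarrow> (complex ^ 'n) set \<Rightarrow> (complex ^ 'n \<Rightarrow> complex) set \<Rightarrow> (complex ^ 'n \<Rightarrow> complex) set \<Rightarrow> real" where
  "bergman_setdist p \<Omega> A B = Inf {bergman_norm p \<Omega> (\<lambda>w. f w - g w) | f g. f \<in> A \<and> g \<in> B}"

end

theory Submission
  imports Defs
begin

text \<open>
  Since \<open>\<Omega>\<close> is bounded, the constants belong to \<open>A\<^sup>p(\<Omega>)\<close>, so \<open>H\<^sup>c\<close> is a translate of
  \<open>H\<^sup>0\<close>. Hence the differences of elements of \<open>H\<^sup>c\<close> and \<open>H\<^sup>c\<^sup>+\<^sup>1\<close> are, up to sign,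
  exactly the elements of \<open>H\<^sup>1\<close>, and \<open>m\<^sub>p(z)\<close> and the distance
  are infima of one and the same set of norms. The mathematical input is therefore that
  \<open>A\<^sup>p(\<Omega>)\<close> is closed under subtraction and contains the constants
  (\<open>bergman_space_diff\<close>, \<open>bergman_space_const\<close>).
\<close>

text \<open>
  Replacing \<open>x\<close> and \<open>y\<close> by the larger of their norms loses at most a factor of \<open>2\<close> inside the power,
  which is harmless since only integrability of the difference is at stake.
\<close>

lemma norm_diff_powr_le:
  fixes x y :: "'a :: real_normed_vector"
  assumes "p \<ge> 0"
  shows "norm (x - y) powr p \<le> 2 powr p * (norm x powr p + norm y powr p)"
proof -
  let ?m = "max (norm x) (norm y)"
  have "norm (x - y) \<le> 2 * ?m"
    using norm_triangle_ineq4[of x y] by linarith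
  then have "norm (x - y) powr p \<le> (2 * ?m) powr p"
    using assms by (intro powr_mono2) auto
  also have "\<dots> = 2 powr p * ?m powr p"
    by (rule powr_mult)
  also have "?m powr p \<le> norm x powr p + norm y powr p"
    by (simp add: max_def)
  finally show ?thesis
    by (simp add: mult_left_mono)
qed

lemma holomorphic_Cn_on_imp_continuous_on:
  assumes "holomorphic_Cn_on f S"
  shows "continuous_on S f"
  using assms unfolding holomorphic_Cn_on_def continuous_on_eq_continuous_within
  by (blast intro: has_derivative_continuous)

lemma holomorphic_Cn_on_const: "holomorphic_Cn_on (\<lambda>_. c) S"
  unfolding holomorphic_Cn_on_def by (auto intro!: exI[of _ "\<lambda>_. 0"])

lemma holomorphic_Cn_on_diff:
  assumes "holomorphic_Cn_on f S" "holomorphic_Cn_on g S"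
  shows "holomorphic_Cn_on (\<lambda>w. f w - g w) S"
  unfolding holomorphic_Cn_on_def
proof
  fix z assume z: "z \<in> S"
  obtain f' g' where
    "(f has_derivative f') (at z within S)" "\<forall>c v. f' (c *s v) = c * f' v"
    "(g has_derivative g') (at z within S)" "\<forall>c v. g' (c *s v) = c * g' v"
    using assms z unfolding holomorphic_Cn_on_def by meson
  then show "\<exists>h'. ((\<lambda>w. f w - g w) has_derivative h') (at z within S) \<and>
      (\<forall>c v. h' (c *s v) = c * h' v)"
    by (intro exI[of _ "\<lambda>v. f' v - g' v"]) (auto simp: right_diff_distrib intro: has_derivative_diff)
qed

lemma bergman_space_const:
  assumes "open \<Omega>" "bounded \<Omega>"
  shows "(\<lambda>_. c) \<in> bergman_space p \<Omega>"
proof -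
  have "set_integrable lebesgue \<Omega> (\<lambda>_. norm c powr p)"
    using assms by (simp add: lmeasurable_open)
  then show ?thesis
    by (simp add: bergman_space_def holomorphic_Cn_on_const)
qed

text \<open>
  Minkowski's inequality is avoided: it suffices to dominate the \<open>p\<close>-th power of the difference
  pointwise by an integrable function, and measurability comes from the continuity of
  holomorphic functions.
\<close>

lemma bergman_space_diff:
  assumes "open \<Omega>" "p \<ge> 0" and f: "f \<in> bergman_space p \<Omega>" and g: "g \<in> bergman_space p \<Omega>"
  shows "(\<lambda>w. f w - g w) \<in> bergman_space p \<Omega>"
proof -
  have hol: "holomorphic_Cn_on (\<lambda>w. f w - g w) \<Omega>"
    using f g by (simp add: bergman_space_def holomorphic_Cn_on_diff)
  have dom: "set_integrable lebesgue \<Omega>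
      (\<lambda>w. 2 powr p * (norm (f w) powr p + norm (g w) powr p))"
    using f g by (intro set_integrable_mult_right set_integral_add) (auto simp: bergman_space_def)
  have "(\<lambda>w. f w - g w) \<in> borel_measurable (lebesgue_on \<Omega>)"
    using hol \<open>open \<Omega>\<close>
    by (intro continuous_imp_measurable_on_sets_lebesgue holomorphic_Cn_on_imp_continuous_on) auto
  then have "(\<lambda>w. norm (f w - g w) powr p) \<in> borel_measurable (lebesgue_on \<Omega>)"
    by measurable
  then have meas: "set_borel_measurable lebesgue \<Omega> (\<lambda>w. norm (f w - g w) powr p)"
    using \<open>open \<Omega>\<close>
    by (simp add: set_borel_measurable_def borel_measurable_restrict_space_iff)
  have "set_integrable lebesgue \<Omega> (\<lambda>w. norm (f w - g w) powr p)"
    by (intro set_integrable_bound[OF dom meas] always_eventually allI impI)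
      (simp add: norm_diff_powr_le \<open>p \<ge> 0\<close>)
  with hol show ?thesis
    by (simp add: bergman_space_def)
qed

lemma bergman_norm_minus_commute:
  "bergman_norm p \<Omega> (\<lambda>w. f w - g w) = bergman_norm p \<Omega> (\<lambda>w. g w - f w)"
  by (simp add: bergman_norm_def norm_minus_commute)

theorem proposition2p14:
  fixes \<Omega> :: "(complex ^ 'n) set" and p :: real and z :: "complex ^ 'n" and c :: complex
  assumes "open \<Omega>" and "connected \<Omega>" and "bounded \<Omega>"
    and "p \<ge> 1"
    and "z \<in> \<Omega>"
  shows "bergman_min p \<Omega> z =
    bergman_setdist p \<Omega> (bergman_hyperplane p \<Omega> z c) (bergman_hyperplane p \<Omega> z (c + 1))"
proof -
  have diff: "(\<lambda>w. f w - g w) \<in> bergman_space p \<Omega>"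
    if "f \<in> bergman_space p \<Omega>" "g \<in> bergman_space p \<Omega>" for f g
    using bergman_space_diff[OF \<open>open \<Omega>\<close> _ that] \<open>p \<ge> 1\<close> by simp
  have const: "(\<lambda>_. a) \<in> bergman_space p \<Omega>" for a
    using bergman_space_const[OF \<open>open \<Omega>\<close> \<open>bounded \<Omega>\<close>] .
  have "{bergman_norm p \<Omega> h | h. h \<in> bergman_space p \<Omega> \<and> h z = 1} =
    {bergman_norm p \<Omega> (\<lambda>w. f w - g w) | f g.
      f \<in> bergman_hyperplane p \<Omega> z c \<and> g \<in> bergman_hyperplane p \<Omega> z (c + 1)}" (is "?L = ?R")
  proof (intro equalityI subsetI)
    fix r assume "r \<in> ?L"
    then obtain h where h: "r = bergman_norm p \<Omega> h" "h \<in> bergman_space p \<Omega>" "h z = 1"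
      by blast
    \<comment> \<open>Translating \<open>h\<close> by the constant \<open>c\<close> realises its norm as a distance from that constant.\<close>
    let ?g = "\<lambda>w. h w - (- c)"
    have "(\<lambda>_. c) \<in> bergman_hyperplane p \<Omega> z c" "?g \<in> bergman_hyperplane p \<Omega> z (c + 1)"
      using const diff[OF h(2) const[of "- c"]] h(3) by (auto simp: bergman_hyperplane_def)
    moreover have "r = bergman_norm p \<Omega> (\<lambda>w. c - ?g w)"
      using h(1) by (subst bergman_norm_minus_commute) simp
    ultimately show "r \<in> ?R"
      unfolding mem_Collect_eq by (intro exI[of _ "\<lambda>_. c"] exI[of _ ?g]) simp
  next
    fix r assume "r \<in> ?R"
    then obtain f g where fg: "r = bergman_norm p \<Omega> (\<lambda>w. f w - g w)"
      "f \<in> bergman_space p \<Omega>" "f z = c" "g \<in> bergman_space p \<Omega>" "g z = c + 1"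
      unfolding bergman_hyperplane_def by blast
    have "r = bergman_norm p \<Omega> (\<lambda>w. g w - f w)"
      using fg(1) bergman_norm_minus_commute by metis
    moreover have "(\<lambda>w. g w - f w) \<in> bergman_space p \<Omega>" "g z - f z = 1"
      using diff fg by auto
    ultimately show "r \<in> ?L"
      by blast
  qed
  then show ?thesis
    by (simp add: bergman_min_def bergman_setdist_def)
qed

end
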